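(* Let $p\in(0,1)$ and let $\mathcal M_1$ be the set of distributions on $\mathbb R$ with finite mean. Define $$e^{\mathrm{ES}}_p(x,r,z)=\frac{(x-z)_+}{(1-p)(r-z)},\qquad x\in\mathbb R,\ z\le r,$$ with the conventions $0/0=1$ and $y/0=\infty$ for $y>0$, and set $e^{\mathrm{ES}}_p(x,r,z)=\infty$ if $r<z$. Then $e^{\mathrm{ES}}_p$ is a monotone backtest e-statistic for $(\mathrm{ES}_p,\mathrm{VaR}_p):\mathcal M_1\to\mathbb R^2$.
   Context: Distributions on $\mathbb R$ are identified with their distribution functions $F$; $y_+=\max\{y,0\}$. For $p\in(0,1)$, $\mathrm{VaR}_p(F)=\inf\{x\in\mathbb R: F(x)\ge p\}$ and $\mathrm{ES}_p(F)=\frac1{1-p}\int_p^1\mathrm{VaR}_\alpha(F)\,\mathrm d\alpha$ for $F\in\mathcal M_1$. Let $\mathcal M$ be a set of distributions on $\mathbb R$ and $\psi=(\rho,\phi):\mathcal M\to\mathbb R\times\mathbb R^{d-1}$. A measurable function $e:\mathbb R^{d+1}\to[0,\infty]$ is a one-sided e-statistic for $\psi$ if $\int_{\mathbb R} e(x,r,\phi(F))\,\mathrm dF(x)\le 1$ for each $F\in\mathcal M$ and each $r\ge\rho(F)$. A one-sided e-statistic $e$ is a backtest e-statistic for $\psi$ if $\int_{\mathbb R}e(x,r,z)\,\mathrm dF(x)>1$ for all $(r,z)\in\psi(\mathcal M)$ and all $F\in\mathcal M$ with $\rho(F)>r$. It is monotone if, in addition, $r\mapsto e(x,r,z)$ is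 decreasing (in the weak sense) for each $(x,z)$. Here $\rho=\mathrm{ES}_p$, $\phi=\mathrm{VaR}_p$, $d=2$. *)

theory Defs
  imports "HOL-Probability.Probability"
begin

text \<open>
  A distribution on the real line is a Borel probability measure F, i.e. \<open>real_distribution F\<close>;
  its distribution function is \<open>cdf F\<close>.
\<close>

definition finite_mean_distributions :: "real measure set" where
  "finite_mean_distributions = {F. real_distribution F \<and> integrable F (\<lambda>x. x)}"

definition VaR :: "real \<Rightarrow> real measure \<Rightarrow> real" where
  "VaR p F = Inf {x. cdf F x \<ge> p}"

text \<open>
  The endpoints are left out because \<open>VaR 1 F\<close> is the infimum of a possibly empty set of
  reals; they form a null set. For F with finite mean the integrand is Lebesgue integrable.
\<close>

definition ES :: "real \<Rightarrow> real measure \<Rightarrow> real" where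
  "ES p F = 1 / (1 - p) * (LINT \<alpha>:{p<..<1}|lborel. VaR \<alpha> F)"

text \<open>
  In the following notions the functional \<open>\<psi> = (\<rho>, \<phi>)\<close> is a pair-valued function of the
  distribution, with \<open>\<rho> = fst \<circ> \<psi>\<close> and \<open>\<phi> = snd \<circ> \<psi>\<close>. Only its values on \<open>\<M>\<close> matter.
\<close>

definition one_sided_e_statistic ::
    "real measure set \<Rightarrow> (real measure \<Rightarrow> real \<times> 'b::euclidean_space)
      \<Rightarrow> (real \<Rightarrow> real \<Rightarrow> 'b \<Rightarrow> ennreal) \<Rightarrow> bool" where
  "one_sided_e_statistic \<M> \<psi> e \<longleftrightarrow>
     (\<lambda>(x, r, z). e x r z) \<in> borel_measurable borel \<and>
     (\<forall>F\<in>\<M>. \<forall>r \<ge> fst (\<psi> F). (\<integral>\<^sup>+ x. e x r (snd (\<psi> F)) \<partial>F) \<le> 1)"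

definition backtest_e_statistic ::
    "real measure set \<Rightarrow> (real measure \<Rightarrow> real \<times> 'b::euclidean_space)
      \<Rightarrow> (real \<Rightarrow> real \<Rightarrow> 'b \<Rightarrow> ennreal) \<Rightarrow> bool" where
  "backtest_e_statistic \<M> \<psi> e \<longleftrightarrow>
     one_sided_e_statistic \<M> \<psi> e \<and>
     (\<forall>(r, z) \<in> \<psi> ` \<M>. \<forall>F\<in>\<M>. fst (\<psi> F) > r \<longrightarrow> (\<integral>\<^sup>+ x. e x r z \<partial>F) > 1)"

definition monotone_backtest_e_statistic ::
    "real measure set \<Rightarrow> (real measure \<Rightarrow> real \<times> 'b::euclidean_space)
      \<Rightarrow> (real \<Rightarrow> real \<Rightarrow> 'b \<Rightarrow> ennreal) \<Rightarrow> bool" where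
  "monotone_backtest_e_statistic \<M> \<psi> e \<longleftrightarrow>
     backtest_e_statistic \<M> \<psi> e \<and> (\<forall>x z. antimono (\<lambda>r. e x r z))"

text \<open>
  Quotient of nonnegative reals with the conventions 0/0 = 1 and y/0 = \<open>\<infinity>\<close> for y > 0;
  neither division on \<open>real\<close> nor division on \<open>ennreal\<close> satisfies the first one.
\<close>

definition quotient_conv :: "real \<Rightarrow> real \<Rightarrow> ennreal" where
  "quotient_conv y w =
     (if w = 0 then (if y = 0 then 1 else \<infinity>) else ennreal (y / w))"

definition e_ES :: "real \<Rightarrow> real \<Rightarrow> real \<Rightarrow> real \<Rightarrow> ennreal" where
  "e_ES p x r z =
     (if r < z then \<infinity> else quotient_conv (max (x - z) 0) ((1 - p) * (r - z)))"

end

theory Submission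
  imports Defs
begin

text \<open>
  If \<open>\<alpha>\<close> is uniform on \<open>(0, 1)\<close>, then \<open>VaR \<alpha> F\<close> has distribution F. Hence the expected excess
  \<open>E (X - z)\<^sub>+\<close> is the integral over \<open>(0, 1)\<close> of \<open>(VaR \<alpha> F - z)\<^sub>+\<close>. Keeping only
  \<open>\<alpha> > p\<close> and dropping the positive part gives \<open>E (X - z)\<^sub>+ \<ge> (1 - p) (ES p F - z)\<close> for
  every z, and nothing is lost if \<open>z = VaR p F\<close>, because the quantile function is increasing.
  The equality yields expectation at most 1, the inequality yields the backtest property.
\<close>

lemma
  fixes g :: "real \<Rightarrow> real"
  assumes "real_distribution F" and [measurable]: "g \<in> borel_measurable borel"
  shows integrable_iff_VaR:
      "integrable F g \<longleftrightarrow> set_integrable lborel {0<..<1} (\<lambda>\<alpha>. g (VaR \<alpha> F))"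
    and integral_eq_VaR: "integral\<^sup>L F g = (LINT \<alpha>:{0<..<1}|lborel. g (VaR \<alpha> F))"
proof -
  interpret cdf_distribution F
    unfolding cdf_distribution_def by fact
  let ?\<Omega> = "restrict_space lborel {0<..<1::real}"
  \<comment> \<open>\<open>I\<close> is the generalized inverse of the distribution function from
    Skorohod's construction, so \<open>distr_I_eq_M\<close> turns both claims into a change of
    variables.\<close>
  have eq: "(\<lambda>\<alpha>. VaR \<alpha> F) = I"
    by (simp add: VaR_def fun_eq_iff)
  have [measurable]: "(\<lambda>\<alpha>. VaR \<alpha> F) \<in> borel_measurable ?\<Omega>"
    using measurable_CI unfolding eq
    by (simp cong: measurable_cong_sets add: sets_restrict_space)
  have F: "F = distr ?\<Omega> borel (\<lambda>\<alpha>. VaR \<alpha> F)"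
    unfolding eq by (rule distr_I_eq_M[symmetric])
  show "integrable F g \<longleftrightarrow> set_integrable lborel {0<..<1} (\<lambda>\<alpha>. g (VaR \<alpha> F))"
    by (subst F, subst integrable_distr_eq)
      (simp_all add: integrable_restrict_space set_integrable_def)
  show "integral\<^sup>L F g = (LINT \<alpha>:{0<..<1}|lborel. g (VaR \<alpha> F))"
    by (subst F, subst integral_distr)
      (simp_all add: integral_restrict_space set_lebesgue_integral_def)
qed

lemma VaR_mono:
  assumes "real_distribution F" and "0 < \<alpha>" "\<alpha> \<le> \<beta>" "\<beta> < 1"
  shows "VaR \<alpha> F \<le> VaR \<beta> F"
proof -
  interpret cdf_distribution F
    unfolding cdf_distribution_def by fact
  show ?thesis
    using mono_onD[OF mono_I, of \<alpha> \<beta>] assms by (simp add: VaR_def)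
qed

text \<open>Ensures that the integral in \<open>ES\<close> is genuine and not the default value
  0.\<close>

lemma set_integrable_VaR:
  assumes "F \<in> finite_mean_distributions" and "0 \<le> p"
  shows "set_integrable lborel {p<..<1} (\<lambda>\<alpha>. VaR \<alpha> F)"
  using assms integrable_iff_VaR[of F "\<lambda>x. x"]
  by (auto simp: finite_mean_distributions_def intro: set_integrable_subset)

lemma
  assumes "0 \<le> p" "p < 1" and "F \<in> finite_mean_distributions"
  shows integrable_VaR_diff: "set_integrable lborel {p<..<1} (\<lambda>\<alpha>. VaR \<alpha> F - z)"
    and integral_VaR_diff: "(LINT \<alpha>:{p<..<1}|lborel. VaR \<alpha> F - z) = (1 - p) * (ES p F - z)"
proof -
  have const: "set_integrable lborel {p<..<1} (\<lambda>\<alpha>. z)"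
    unfolding set_integrable_def
    by (intro integrable_scaleR_left integrable_real_indicator) (use \<open>p < 1\<close> in simp_all)
  note int = set_integrable_VaR[OF assms(3,1)]
  show "set_integrable lborel {p<..<1} (\<lambda>\<alpha>. VaR \<alpha> F - z)"
    using int const by (rule set_integral_diff)
  have "(LINT \<alpha>:{p<..<1}|lborel. VaR \<alpha> F - z) = (1 - p) * ES p F - (1 - p) * z"
    using assms by (simp add: set_integral_diff(2)[OF int const] ES_def set_integral_const)
  then show "(LINT \<alpha>:{p<..<1}|lborel. VaR \<alpha> F - z) = (1 - p) * (ES p F - z)"
    by (simp add: algebra_simps)
qed

lemma integrable_excess:
  assumes "F \<in> finite_mean_distributions"
  shows "integrable F (\<lambda>x. max (x - z) 0)"
proof -
  interpret real_distribution F
    using assms by (simp add: finite_mean_distributions_def)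
  show ?thesis
    using assms by (auto simp: finite_mean_distributions_def intro!: integrable_max)
qed

lemma expected_excess_ge_ES:
  assumes "0 \<le> p" "p < 1" and F: "F \<in> finite_mean_distributions"
  shows "(1 - p) * (ES p F - z) \<le> (LINT x|F. max (x - z) 0)"
proof -
  have rd: "real_distribution F"
    using F by (simp add: finite_mean_distributions_def)
  have int: "set_integrable lborel {0<..<1} (\<lambda>\<alpha>. max (VaR \<alpha> F - z) 0)"
    using integrable_excess[OF F, of z] integrable_iff_VaR[OF rd, of "\<lambda>x. max (x - z) 0"]
    by simp
  have "(LINT \<alpha>:{p<..<1}|lborel. VaR \<alpha> F - z) \<le> (LINT \<alpha>:{0<..<1}|lborel. max (VaR \<alpha> F - z) 0)"
    using integrable_VaR_diff[OF assms] int \<open>0 \<le> p\<close>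
    unfolding set_lebesgue_integral_def set_integrable_def
    by (intro integral_mono) (auto simp: indicator_def)
  then show ?thesis
    using integral_eq_VaR[OF rd, of "\<lambda>x. max (x - z) 0"] integral_VaR_diff[OF assms] by simp
qed

lemma expected_excess_VaR:
  assumes "0 < p" "p < 1" and F: "F \<in> finite_mean_distributions"
  shows "(LINT x|F. max (x - VaR p F) 0) = (1 - p) * (ES p F - VaR p F)"
proof -
  have rd: "real_distribution F"
    using F by (simp add: finite_mean_distributions_def)
  \<comment> \<open>Below p monotonicity makes the positive part vanish, above p the difference is
    already nonnegative, and at \<open>\<alpha> = p\<close> both sides are 0.\<close>
  have "indicat_real {0<..<1} \<alpha> *\<^sub>R max (VaR \<alpha> F - VaR p F) 0
      = indicat_real {p<..<1} \<alpha> *\<^sub>R (VaR \<alpha> F - VaR p F)" for \<alpha>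
    using VaR_mono[OF rd, of \<alpha> p] VaR_mono[OF rd, of p \<alpha>] assms by (auto simp: indicator_def)
  then have "(LINT \<alpha>:{0<..<1}|lborel. max (VaR \<alpha> F - VaR p F) 0)
      = (LINT \<alpha>:{p<..<1}|lborel. VaR \<alpha> F - VaR p F)"
    by (simp only: set_lebesgue_integral_def)
  then show ?thesis
    using integral_eq_VaR[OF rd, of "\<lambda>x. max (x - VaR p F) 0"] integral_VaR_diff[of p F] assms
    by simp
qed

text \<open>The difference, scaled by \<open>1 - p\<close>, is an expected excess. Thus every value
  \<open>(r, z)\<close> of the functional has \<open>z \<le> r\<close> and stays off the branch
  where \<open>e_ES\<close> is \<infinity> by definition.\<close>

lemma VaR_le_ES:
  assumes "0 < p" "p < 1" and "F \<in> finite_mean_distributions"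
  shows "VaR p F \<le> ES p F"
proof -
  have "0 \<le> (LINT x|F. max (x - VaR p F) 0)"
    by simp
  then show ?thesis
    using assms expected_excess_VaR[OF assms] by (simp add: zero_le_mult_iff)
qed

lemma nn_integral_e_ES:
  assumes "p < 1" "z < r" and F: "F \<in> finite_mean_distributions"
  shows "(\<integral>\<^sup>+ x. e_ES p x r z \<partial>F)
    = ennreal ((LINT x|F. max (x - z) 0) / ((1 - p) * (r - z)))"
proof -
  have "(\<integral>\<^sup>+ x. e_ES p x r z \<partial>F)
      = (\<integral>\<^sup>+ x. ennreal (max (x - z) 0 / ((1 - p) * (r - z))) \<partial>F)"
    using assms by (simp add: e_ES_def quotient_conv_def)
  also have "\<dots> = ennreal (LINT x|F. max (x - z) 0 / ((1 - p) * (r - z)))"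
    using assms integrable_excess[OF F, of z] by (intro nn_integral_eq_integral) auto
  finally show ?thesis
    by simp
qed

lemma antimono_e_ES:
  assumes "p < 1"
  shows "antimono (\<lambda>r. e_ES p x r z)"
proof (rule antimonoI)
  fix r s :: real
  assume "r \<le> s"
  then consider "r < z" | "r = z" | "z < r" by linarith
  then show "e_ES p x s z \<le> e_ES p x r z"
  proof cases
    case 3
    with assms \<open>r \<le> s\<close> show ?thesis
      by (auto simp: e_ES_def quotient_conv_def intro!: ennreal_leI divide_left_mono)
  \<comment> \<open>If \<open>r = z\<close> and \<open>x \<le> z\<close>, the value 1 of 0/0 falls
    to 0 as soon as \<open>s > z\<close>; otherwise the value at r is \<infinity>.\<close>
  qed (use assms \<open>r \<le> s\<close> in \<open>auto simp: e_ES_def quotient_conv_def\<close>)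
qed

lemma measurable_e_ES: "(\<lambda>(x, r, z). e_ES p x r z) \<in> borel_measurable borel"
  unfolding e_ES_def quotient_conv_def borel_prod[symmetric] by measurable

lemma nn_integral_e_ES_le_1:
  assumes "0 < p" "p < 1" and F: "F \<in> finite_mean_distributions" and "ES p F \<le> r"
  shows "(\<integral>\<^sup>+ x. e_ES p x r (VaR p F) \<partial>F) \<le> 1"
proof -
  note excess = expected_excess_VaR[OF assms(1-3)]
  have "VaR p F \<le> ES p F"
    by (rule VaR_le_ES[OF assms(1-3)])
  \<comment> \<open>A vanishing denominator forces r, \<open>ES p F\<close> and
    \<open>VaR p F\<close> to coincide.\<close>
  then consider "VaR p F < r" | "r = VaR p F" "ES p F = VaR p F"
    using \<open>ES p F \<le> r\<close> by linarith
  then show ?thesis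
  proof cases
    case 1
    have "(1 - p) * (ES p F - VaR p F) / ((1 - p) * (r - VaR p F)) \<le> 1"
      using 1 assms by (simp add: divide_simps)
    then show ?thesis
      by (simp only: nn_integral_e_ES[OF \<open>p < 1\<close> 1 F] excess ennreal_le_1)
  next
    case 2
    interpret real_distribution F
      using F by (simp add: finite_mean_distributions_def)
    \<comment> \<open>The expected excess is now 0, so almost surely the quotient is 0/0 = 1 and its
      expectation is exactly 1.\<close>
    have "AE x in F. max (x - VaR p F) 0 = 0"
      using integral_nonneg_eq_0_iff_AE[OF integrable_excess[OF F, of "VaR p F"]] excess 2
      by simp
    then have "AE x in F. e_ES p x r (VaR p F) = 1"
      using 2 by (auto simp: e_ES_def quotient_conv_def)
    then have "(\<integral>\<^sup>+ x. e_ES p x r (VaR p F) \<partial>F) = (\<integral>\<^sup>+ x. 1 \<partial>F)"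
      by (rule nn_integral_cong_AE)
    then show ?thesis
      using prob_space by (simp add: emeasure_eq_measure)
  qed
qed

text \<open>Here z may be the quantile of another distribution, so only the lower bound on the
  expected excess is available; \<open>r < ES p F\<close> makes it strict.\<close>

lemma nn_integral_e_ES_gt_1:
  assumes "0 \<le> p" "p < 1" and F: "F \<in> finite_mean_distributions"
    and "z \<le> r" "r < ES p F"
  shows "1 < (\<integral>\<^sup>+ x. e_ES p x r z \<partial>F)"
proof -
  \<comment> \<open>Passing to a slightly larger level avoids the division by 0 that occurs if \<open>r = z\<close>.\<close>
  obtain s where s: "r < s" "s < ES p F"
    using dense \<open>r < ES p F\<close> by blast
  have "(1 - p) * (s - z) < (1 - p) * (ES p F - z)"
    using s \<open>p < 1\<close> by simp
  also have "\<dots> \<le> (LINT x|F. max (x - z) 0)"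
    by (rule expected_excess_ge_ES[OF assms(1-3)])
  finally have "1 < (LINT x|F. max (x - z) 0) / ((1 - p) * (s - z))"
    using s assms by (simp add: less_divide_eq)
  then have "1 < (\<integral>\<^sup>+ x. e_ES p x s z \<partial>F)"
    using s \<open>z \<le> r\<close> nn_integral_e_ES[OF \<open>p < 1\<close> _ F, of z s] by simp
  \<comment> \<open>Monotonicity in the level carries the bound from s back to r, including
    \<open>r = z\<close>.\<close>
  also have "\<dots> \<le> (\<integral>\<^sup>+ x. e_ES p x r z \<partial>F)"
    using antimonoD[OF antimono_e_ES[OF \<open>p < 1\<close>]] s by (intro nn_integral_mono) simp
  finally show ?thesis .
qed

theorem theorem1:
  fixes p :: real
  assumes "0 < p" and "p < 1"
  shows "monotone_backtest_e_statistic finite_mean_distributions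
           (\<lambda>F. (ES p F, VaR p F)) (e_ES p)"
  unfolding monotone_backtest_e_statistic_def backtest_e_statistic_def one_sided_e_statistic_def
  using assms
  by (auto simp: measurable_e_ES antimono_e_ES VaR_le_ES
      intro: nn_integral_e_ES_le_1 nn_integral_e_ES_gt_1)

end
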